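(* For any finite simple graph $G$ without isolated vertices, $\operatorname{im}(\widetilde{G})\ge a_3(G)$. In particular, if $G$ is claw-free, then $\operatorname{im}(\widetilde{G})=a_3(G)$.
   Context: $\widetilde{G}$ is the second power of $G$: the graph with vertex set $V(G)$ and edge set $E(\widetilde{G})=E(G)\cup\{\{i,j\}: i\ne j,\ i,j\in N_G(p)\text{ for some }p\in V(G)\}$, where $N_G(p)$ is the open neighborhood of $p$. A matching is a set of pairwise disjoint edges; an induced matching of a graph $H$ is a matching that forms an induced subgraph of $H$ (no edge of $H$ joins two distinct edges of the matching), and $\operatorname{im}(H)$ is the maximum size of an induced matching of $H$. For two edges $e,e'\in E(G)$, the distance $\operatorname{dist}_G(e,e')$ is the minimum integer $r$ such that there is a sequence $e,e_1,\ldots,e_r,e'$ forming the edges of a path in $G$ connecting $e$ and $e'$ (taken to be $\infty$ if there is no such path). A distance-three matching of $G$ is a set $M$ of edges of $G$ such that $\operatorname{dist}_G(e,e')\ge3$ for any two distinct $e,e'\in M$; $a_3(G)$ is the maximum size of a distance-three matching of $G$. $G$ is claw-free if it has no induced subgraph isomorphic to the complete bipartite graph $K_{1,3}$. *)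

theory Defs
  imports Main "HOL-Library.Extended_Nat" "HOL-Library.Disjoint_Sets"
begin

record 'a graph =
  verts :: "'a set"
  edges :: "'a set set"

definition finite_simple_graph :: "'a graph \<Rightarrow> bool" where
  "finite_simple_graph G \<longleftrightarrow>
     finite (verts G) \<and> (\<forall>e\<in>edges G. e \<subseteq> verts G \<and> card e = 2)"

definition nbhd :: "'a graph \<Rightarrow> 'a \<Rightarrow> 'a set" where
  "nbhd G p = {v \<in> verts G. {p, v} \<in> edges G}"

definition no_isolated_vertices :: "'a graph \<Rightarrow> bool" where
  "no_isolated_vertices G \<longleftrightarrow> (\<forall>v\<in>verts G. nbhd G v \<noteq> {})"

definition second_power :: "'a graph \<Rightarrow> 'a graph" where
  "second_power G =
     \<lparr>verts = verts G,
      edges = edges G \<union>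
        {{i, j} | i j. i \<noteq> j \<and> (\<exists>p\<in>verts G. i \<in> nbhd G p \<and> j \<in> nbhd G p)}\<rparr>"

definition induced_subgraph :: "'a graph \<Rightarrow> 'a set \<Rightarrow> 'a graph" where
  "induced_subgraph G S = \<lparr>verts = S, edges = {e \<in> edges G. e \<subseteq> S}\<rparr>"

definition matching :: "'a graph \<Rightarrow> 'a set set \<Rightarrow> bool" where
  "matching G M \<longleftrightarrow> M \<subseteq> edges G \<and> pairwise disjnt M"

definition induced_matching :: "'a graph \<Rightarrow> 'a set set \<Rightarrow> bool" where
  "induced_matching G M \<longleftrightarrow>
     matching G M \<and> induced_subgraph G (\<Union>M) = \<lparr>verts = \<Union>M, edges = M\<rparr>"

definition im :: "'a graph \<Rightarrow> nat" where
  "im G = Max {card M | M. induced_matching G M}"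

fun path_edges :: "'a list \<Rightarrow> 'a set list" where
  "path_edges (u # v # vs) = {u, v} # path_edges (v # vs)"
| "path_edges vs = []"

definition is_path :: "'a graph \<Rightarrow> 'a list \<Rightarrow> bool" where
  "is_path G vs \<longleftrightarrow>
     vs \<noteq> [] \<and> distinct vs \<and> set vs \<subseteq> verts G \<and> set (path_edges vs) \<subseteq> edges G"

text \<open>The value is the number of edges strictly between the end edges \<open>e\<close> and \<open>e'\<close> of a
  path, so distinct edges sharing a vertex have distance 0. If no path exists, the infimum over
  the empty set is \<open>\<infinity>\<close>. Only distinct edges are ever compared.\<close>

definition edge_dist :: "'a graph \<Rightarrow> 'a set \<Rightarrow> 'a set \<Rightarrow> enat" where
  "edge_dist G e e' =
     Inf {enat (length es) | es. \<exists>vs. is_path G vs \<and> path_edges vs = e # es @ [e']}"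

definition distance_three_matching :: "'a graph \<Rightarrow> 'a set set \<Rightarrow> bool" where
  "distance_three_matching G M \<longleftrightarrow>
     M \<subseteq> edges G \<and> (\<forall>e\<in>M. \<forall>e'\<in>M. e \<noteq> e' \<longrightarrow> edge_dist G e e' \<ge> 3)"

definition a3 :: "'a graph \<Rightarrow> nat" where
  "a3 G = Max {card M | M. distance_three_matching G M}"

definition graph_isomorphic :: "'a graph \<Rightarrow> 'b graph \<Rightarrow> bool" where
  "graph_isomorphic G H \<longleftrightarrow>
     (\<exists>f. bij_betw f (verts G) (verts H) \<and>
          (\<forall>u\<in>verts G. \<forall>v\<in>verts G. {u, v} \<in> edges G \<longleftrightarrow> {f u, f v} \<in> edges H))"

definition complete_bipartite :: "nat \<Rightarrow> nat \<Rightarrow> (nat + nat) graph" where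
  "complete_bipartite m n =
     \<lparr>verts = {..<m} <+> {..<n}, edges = {{Inl i, Inr j} | i j. i < m \<and> j < n}\<rparr>"

definition claw_free :: "'a graph \<Rightarrow> bool" where
  "claw_free G \<longleftrightarrow>
     \<not> (\<exists>S\<subseteq>verts G. graph_isomorphic (induced_subgraph G S) (complete_bipartite 1 3))"

end

theory Submission
  imports Defs
begin

text \<open>Call two vertices remote if they are distinct and not adjacent in the second power, that
  is, if their distance in \<open>G\<close> is at least three. Both kinds of matching are sets of edges in which
  any two distinct members are joined by remote pairs only; for a distance-three matching
  (\<open>distance_three_matching_iff_mutually_remote\<close>) the edges come from \<open>G\<close>, and for an induced
  matching of the second power (\<open>induced_matching_second_power_iff_mutually_remote\<close>) they come
  from the second power. As the latter has more edges, the inequality follows.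

  If \<open>G\<close> is claw-free, an edge \<open>{i, j}\<close> of the second power that is not in \<open>G\<close> can be traded for the
  edge \<open>{i, p}\<close> of \<open>G\<close>, where \<open>p\<close> is a common neighbour of \<open>i\<close> and \<open>j\<close>: a vertex \<open>x\<close> remote
  from \<open>i\<close> and \<open>j\<close> is remote from \<open>p\<close> too, since a path \<open>p, q, x\<close> would give a claw with centre
  \<open>p\<close> and leaves \<open>i\<close>, \<open>j\<close>, \<open>q\<close> (\<open>claw_free_remote_common_neighbour\<close>). This exchange concerns one
  edge and an arbitrary vertex \<open>x\<close>, so it can be made first at one of two matching edges and then
  at the other. Trading all edges of an induced matching in this way therefore gives a
  distance-three matching of the same size.\<close>

section \<open>Remote vertices\<close>

definition remote :: "'a graph \<Rightarrow> 'a \<Rightarrow> 'a \<Rightarrow> bool" where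
  "remote G u x \<longleftrightarrow> u \<noteq> x \<and> {u, x} \<notin> edges (second_power G)"

definition mutually_remote :: "'a graph \<Rightarrow> 'a set set \<Rightarrow> bool" where
  "mutually_remote G M \<longleftrightarrow>
     (\<forall>e\<in>M. \<forall>e'\<in>M. e \<noteq> e' \<longrightarrow> (\<forall>u\<in>e. \<forall>x\<in>e'. remote G u x))"

lemma remote_sym: "remote G u x \<longleftrightarrow> remote G x u"
  by (auto simp: remote_def insert_commute)

lemma edge_vertices:
  assumes "finite_simple_graph G" "{u, v} \<in> edges G"
  shows "u \<in> verts G" "v \<in> verts G" "u \<noteq> v"
proof -
  have "{u, v} \<subseteq> verts G" "card {u, v} = 2"
    using assms by (auto simp: finite_simple_graph_def)
  then show "u \<in> verts G" "v \<in> verts G" "u \<noteq> v"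
    by auto
qed

lemma mem_edges_second_power:
  assumes "finite_simple_graph G"
  shows "e \<in> edges (second_power G) \<longleftrightarrow>
    e \<in> edges G \<or>
    (\<exists>i j p. e = {i, j} \<and> i \<noteq> j \<and> {p, i} \<in> edges G \<and> {p, j} \<in> edges G)"
proof -
  have "(p \<in> verts G \<and> i \<in> nbhd G p \<and> j \<in> nbhd G p) \<longleftrightarrow>
      {p, i} \<in> edges G \<and> {p, j} \<in> edges G" for p i j
    using edge_vertices[OF assms] unfolding nbhd_def by blast
  then show ?thesis
    by (simp add: second_power_def) blast
qed

lemma remote_iff:
  assumes "finite_simple_graph G"
  shows "remote G u x \<longleftrightarrow>
    u \<noteq> x \<and> {u, x} \<notin> edges G \<and> \<not> (\<exists>p. {p, u} \<in> edges G \<and> {p, x} \<in> edges G)"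
  unfolding remote_def mem_edges_second_power[OF assms]
  by (auto simp: doubleton_eq_iff)

lemma finite_simple_graph_second_power:
  assumes "finite_simple_graph G"
  shows "finite_simple_graph (second_power G)"
proof -
  have "e \<subseteq> verts G \<and> card e = 2" if "e \<in> edges (second_power G)" for e
    using that assms edge_vertices[OF assms]
    unfolding mem_edges_second_power[OF assms] by (auto simp: finite_simple_graph_def)
  moreover have "verts (second_power G) = verts G"
    by (simp add: second_power_def)
  ultimately show ?thesis
    using assms by (auto simp: finite_simple_graph_def)
qed

lemma finite_edges:
  assumes "finite_simple_graph G"
  shows "finite (edges G)"
  using assms by (auto simp: finite_simple_graph_def intro: finite_subset[of _ "Pow (verts G)"])

section \<open>Both kinds of matching in terms of remoteness\<close>

text \<open>A path from \<open>e\<close> to \<open>e'\<close> with \<open>k\<close> edges in between has \<open>k + 3\<close> vertices, of which the second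
  lies in \<open>e\<close>, the last but one in \<open>e'\<close>, and these two are at distance at most \<open>k\<close>. Conversely, a
  shortest connection between a vertex of \<open>e\<close> and a vertex of \<open>e'\<close> extends to such a path by the
  two remaining end vertices.\<close>

lemma short_path_between_non_remote_edges:
  assumes G: "finite_simple_graph G"
    and edges: "e \<in> edges G" "e' \<in> edges G" "e \<noteq> e'"
    and near: "\<exists>u\<in>e. \<exists>x\<in>e'. \<not> remote G u x"
  shows "\<exists>es vs. length es < 3 \<and> is_path G vs \<and> path_edges vs = e # es @ [e']"
proof -
  have other_end: "\<exists>a. f = {a, u}" if "f \<in> edges G" "u \<in> f" for f u
    using that G by (auto simp: finite_simple_graph_def card_2_iff)
  have is_path: "is_path G vs"
    if "set (path_edges vs) \<subseteq> edges G" "set vs \<subseteq> verts G" "vs \<noteq> []" "distinct vs" for vs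
    using that by (simp add: is_path_def)
  note V = edge_vertices[OF G]
  consider (meet) u where "u \<in> e" "u \<in> e'"
    | (adjacent) u x where "u \<in> e" "x \<in> e'" "{u, x} \<in> edges G" "e \<inter> e' = {}"
    | (common) u x p where "u \<in> e" "x \<in> e'" "{p, u} \<in> edges G" "{p, x} \<in> edges G"
        "e \<inter> e' = {}" "\<forall>v\<in>e. \<forall>y\<in>e'. {v, y} \<notin> edges G"
    using near unfolding remote_iff[OF G] by blast
  then show ?thesis
  proof cases
    case meet
    then obtain a d where ends: "e = {a, u}" "e' = {d, u}"
      using other_end edges by meson
    have "is_path G [a, u, d]"
      using edges V[of a u] V[of d u] unfolding ends
      by (intro is_path) (auto simp: insert_commute)
    then show ?thesis
      by (intro exI[of _ "[]"] exI[of _ "[a, u, d]"]) (auto simp: ends)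
  next
    case adjacent
    then obtain a d where ends: "e = {a, u}" "e' = {d, x}"
      using other_end edges by meson
    have "is_path G [a, u, x, d]"
      using edges adjacent V[of a u] V[of d x] unfolding ends
      by (intro is_path) (auto simp: insert_commute)
    then show ?thesis
      by (intro exI[of _ "[{u, x}]"] exI[of _ "[a, u, x, d]"]) (auto simp: ends)
  next
    case common
    then obtain a d where ends: "e = {a, u}" "e' = {d, x}"
      using other_end edges by meson
    \<comment> \<open>If \<open>p\<close> were \<open>a\<close> or \<open>d\<close>, an edge of \<open>G\<close> would join \<open>e\<close> and \<open>e'\<close> directly.\<close>
    have "p \<noteq> a" "p \<noteq> d"
      using common unfolding ends by (auto simp: insert_commute)
    then have "is_path G [a, u, p, x, d]"
      using edges common V[of a u] V[of d x] V[of p u] V[of p x] unfolding ends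
      by (intro is_path) (auto simp: insert_commute)
    then show ?thesis
      by (intro exI[of _ "[{u, p}, {p, x}]"] exI[of _ "[a, u, p, x, d]"]) (auto simp: ends)
  qed
qed

lemma length_path_edges: "length (path_edges vs) = length vs - 1"
  by (induction vs rule: path_edges.induct) auto

lemma short_path_joins_non_remote_edges:
  assumes G: "finite_simple_graph G"
    and vs: "is_path G vs" "path_edges vs = e # es @ [e']"
    and short: "length es < 3"
  shows "\<exists>u\<in>e. \<exists>x\<in>e'. \<not> remote G u x"
proof -
  have len: "length vs = length es + 3"
    using arg_cong[OF vs(2), of length] by (simp add: length_path_edges)
  consider "es = []" | f where "es = [f]" | f g where "es = [f, g]"
    using short by (auto simp: numeral_3_eq_3 less_Suc_eq length_Suc_conv)
  then show ?thesis
  proof cases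
    case 1
    then obtain a b c where "vs = [a, b, c]"
      using len
      by (auto simp: numeral_3_eq_3 length_Suc_conv)
    with vs 1 show ?thesis
      by (auto simp: remote_iff[OF G])
  next
    case 2
    then obtain a b c d where "vs = [a, b, c, d]"
      using len
      by (auto simp: numeral_3_eq_3 length_Suc_conv)
    with vs 2 show ?thesis
      by (auto simp: remote_iff[OF G] is_path_def)
  next
    case 3
    then obtain a b c d h where "vs = [a, b, c, d, h]"
      using len
      by (auto simp: numeral_3_eq_3 length_Suc_conv)
    with vs 3 show ?thesis
      by (auto simp: remote_iff[OF G] is_path_def insert_commute)
  qed
qed

lemma edge_dist_ge_3_iff_remote:
  assumes "finite_simple_graph G" "e \<in> edges G" "e' \<in> edges G" "e \<noteq> e'"
  shows "edge_dist G e e' \<ge> 3 \<longleftrightarrow> (\<forall>u\<in>e. \<forall>x\<in>e'. remote G u x)"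
proof -
  have "(3 :: enat) \<le> enat n \<longleftrightarrow> \<not> n < 3" for n
    by (simp add: numeral_eq_enat not_less)
  then have "edge_dist G e e' \<ge> 3 \<longleftrightarrow>
      \<not> (\<exists>es vs. length es < 3 \<and> is_path G vs \<and> path_edges vs = e # es @ [e'])"
    unfolding edge_dist_def le_Inf_iff by blast
  also have "\<dots> \<longleftrightarrow> \<not> (\<exists>u\<in>e. \<exists>x\<in>e'. \<not> remote G u x)"
    using short_path_between_non_remote_edges[OF assms]
      short_path_joins_non_remote_edges[OF assms(1)] by metis
  finally show ?thesis
    by blast
qed

lemma distance_three_matching_iff_mutually_remote:
  assumes "finite_simple_graph G"
  shows "distance_three_matching G M \<longleftrightarrow> M \<subseteq> edges G \<and> mutually_remote G M"
  using edge_dist_ge_3_iff_remote[OF assms]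
  unfolding distance_three_matching_def mutually_remote_def by (meson subsetD)

text \<open>Remoteness of vertices in different members says both that the members are disjoint and
  that no edge of the second power joins them. An edge within one member is that member, because
  both have two elements.\<close>

lemma induced_matching_second_power_iff_mutually_remote:
  assumes "finite_simple_graph G"
  shows "induced_matching (second_power G) M \<longleftrightarrow>
    M \<subseteq> edges (second_power G) \<and> mutually_remote G M"
proof (intro iffI conjI)
  let ?H = "second_power G"
  have two: "\<exists>u x. f = {u, x} \<and> u \<noteq> x" if "f \<in> edges ?H" for f
    using that finite_simple_graph_second_power[OF assms]
    by (auto simp: finite_simple_graph_def card_2_iff)
  {
    assume M: "induced_matching ?H M"
    then show sub: "M \<subseteq> edges ?H"
      by (simp add: induced_matching_def matching_def)
    have disj: "e = e'" if "e \<in> M" "e' \<in> M" "u \<in> e" "u \<in> e'" for e e' u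
      using M that by (auto simp: induced_matching_def matching_def pairwise_def disjnt_def)
    have closed: "f \<in> M" if "f \<in> edges ?H" "f \<subseteq> \<Union>M" for f
      using M that by (auto simp: induced_matching_def induced_subgraph_def)
    show "mutually_remote G M"
      unfolding mutually_remote_def remote_def
    proof (intro ballI impI conjI notI)
      fix e e' u x
      assume e: "e \<in> M" "e' \<in> M" "e \<noteq> e'" "u \<in> e" "x \<in> e'"
      show False if "u = x"
        using disj e that by blast
      show False if "{u, x} \<in> edges ?H"
      proof -
        have "{u, x} \<in> M"
          using closed[OF that] e by auto
        then have "{u, x} = e" "{u, x} = e'"
          using disj e by blast+
        with e(3) show False
          by simp
      qed
    qed
  }
  assume M: "M \<subseteq> edges ?H \<and> mutually_remote G M"
  have "pairwise disjnt M"
    using M unfolding pairwise_def disjnt_def mutually_remote_def remote_def by blast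
  moreover have "f \<in> M" if f: "f \<in> edges ?H" "f \<subseteq> \<Union>M" for f
  proof -
    obtain u x where ux: "f = {u, x}" "u \<noteq> x"
      using two f by blast
    then obtain e e' where e: "e \<in> M" "e' \<in> M" "u \<in> e" "x \<in> e'"
      using f by auto
    with M f ux have "e = e'"
      unfolding mutually_remote_def remote_def by blast
    moreover obtain a b where "e = {a, b}"
      using two M e by blast
    ultimately have "e = f"
      using e ux by auto
    with e show ?thesis
      by simp
  qed
  ultimately show "induced_matching ?H M"
    using M by (auto simp: induced_matching_def matching_def induced_subgraph_def)
qed

section \<open>Exchanging edges in a claw-free graph\<close>

lemma claw_free_leaves_adjacent:
  assumes G: "finite_simple_graph G" and free: "claw_free G"
    and centre: "{p, i} \<in> edges G" "{p, j} \<in> edges G" "{p, q} \<in> edges G"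
    and leaves: "i \<noteq> j" "i \<noteq> q" "j \<noteq> q"
  shows "{i, j} \<in> edges G \<or> {i, q} \<in> edges G \<or> {j, q} \<in> edges G"
proof (rule ccontr)
  assume "\<not> ?thesis"
  then have nonadj: "{i, j} \<notin> edges G" "{i, q} \<notin> edges G" "{j, q} \<notin> edges G"
    by auto
  have loop: "{v, v} \<notin> edges G" for v
    using edge_vertices[OF G, of v v] by auto
  note V = edge_vertices[OF G centre(1)] edge_vertices[OF G centre(2)]
    edge_vertices[OF G centre(3)]
  let ?S = "{p, i, j, q}"
  define f :: "'a \<Rightarrow> nat + nat" where
    "f v = (if v = p then Inl 0 else if v = i then Inr 0 else if v = j then Inr 1 else Inr 2)"
    for v
  have f: "f p = Inl 0" "f i = Inr 0" "f j = Inr 1" "f q = Inr 2"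
    using V leaves by (auto simp: f_def)
  have verts_K: "verts (complete_bipartite 1 3) = {Inl 0, Inr 0, Inr 1, Inr 2}"
    by (auto simp: complete_bipartite_def)
  have edges_K: "{s, t} \<in> edges (complete_bipartite 1 3) \<longleftrightarrow>
      (\<exists>k<3. s = Inl 0 \<and> t = Inr k \<or> s = Inr k \<and> t = Inl 0)" for s t
    by (auto simp: complete_bipartite_def doubleton_eq_iff)
  have "bij_betw f ?S (verts (complete_bipartite 1 3))"
    unfolding bij_betw_def inj_on_def verts_K using f by auto
  moreover have "{u, v} \<in> edges G \<longleftrightarrow> {f u, f v} \<in> edges (complete_bipartite 1 3)"
    if "u \<in> ?S" "v \<in> ?S" for u v
    using that f centre nonadj loop unfolding edges_K by (auto simp: insert_commute)
  ultimately have "graph_isomorphic (induced_subgraph G ?S) (complete_bipartite 1 3)"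
    unfolding graph_isomorphic_def by (intro exI[of _ f]) (auto simp: induced_subgraph_def)
  moreover have "?S \<subseteq> verts G"
    using V by auto
  ultimately show False
    using free unfolding claw_free_def by blast
qed

text \<open>The vertex \<open>x\<close> cannot be \<open>p\<close> or a neighbour of \<open>p\<close>, as it would then be within distance two
  of \<open>i\<close>. A path \<open>p, q, x\<close> would make \<open>q\<close> a third neighbour of \<open>p\<close>, distinct from and adjacent to
  neither \<open>i\<close> nor \<open>j\<close>, as these are remote from \<open>x\<close>.\<close>

lemma claw_free_remote_common_neighbour:
  assumes G: "finite_simple_graph G" and free: "claw_free G"
    and p: "{p, i} \<in> edges G" "{p, j} \<in> edges G"
    and nonadj: "i \<noteq> j" "{i, j} \<notin> edges G"
    and remote: "remote G i x" "remote G j x"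
  shows "remote G p x"
proof -
  have "p \<noteq> x" "{p, x} \<notin> edges G"
    using remote p unfolding remote_iff[OF G] by (auto simp: insert_commute)
  moreover have False if q: "{q, p} \<in> edges G" "{q, x} \<in> edges G" for q
  proof -
    have "i \<noteq> q" "j \<noteq> q" "{i, q} \<notin> edges G" "{j, q} \<notin> edges G"
      using remote q unfolding remote_iff[OF G] by (auto simp: insert_commute)
    moreover have "{p, q} \<in> edges G"
      using q by (simp add: insert_commute)
    ultimately show False
      using claw_free_leaves_adjacent[OF G free p] nonadj by blast
  qed
  ultimately show ?thesis
    unfolding remote_iff[OF G] by blast
qed

lemma claw_free_exchange_edge:
  assumes G: "finite_simple_graph G" and free: "claw_free G"
    and e: "e \<in> edges (second_power G)"
  shows "\<exists>e'\<in>edges G. \<forall>x. (\<forall>u\<in>e. remote G u x) \<longrightarrow> (\<forall>u\<in>e'. remote G u x)"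
proof (cases "e \<in> edges G")
  case True
  then show ?thesis
    by blast
next
  case False
  with e obtain i j p where ij: "e = {i, j}" "i \<noteq> j" "{p, i} \<in> edges G" "{p, j} \<in> edges G"
    unfolding mem_edges_second_power[OF G] by blast
  then show ?thesis
    using claw_free_remote_common_neighbour[OF G free ij(3,4,2)] False
    by (intro bexI[of _ "{p, i}"]) auto
qed

text \<open>The exchange property of a single edge holds against every vertex \<open>x\<close>. For two members
  \<open>e\<close> and \<open>e'\<close> it is applied first to \<open>e\<close> against the vertices of \<open>e'\<close>, and then to \<open>e'\<close> against
  the vertices of the edge that replaced \<open>e\<close>. The exchange is injective since the new edges are
  nonempty and no vertex is remote from itself.\<close>

lemma claw_free_exchange_matching:
  assumes G: "finite_simple_graph G" and free: "claw_free G"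
    and M: "M \<subseteq> edges (second_power G)" "mutually_remote G M"
  shows "\<exists>N\<subseteq>edges G. mutually_remote G N \<and> card N = card M"
proof -
  have "\<forall>e\<in>M. \<exists>e'. e' \<in> edges G \<and>
      (\<forall>x. (\<forall>u\<in>e. remote G u x) \<longrightarrow> (\<forall>u\<in>e'. remote G u x))"
    using claw_free_exchange_edge[OF G free] M(1) by blast
  then obtain r where r: "\<And>e. e \<in> M \<Longrightarrow> r e \<in> edges G"
    and exchange: "\<And>e x u. \<lbrakk>e \<in> M; \<forall>v\<in>e. remote G v x; u \<in> r e\<rbrakk> \<Longrightarrow> remote G u x"
    by metis
  have far: "remote G u x" if "e \<in> M" "e' \<in> M" "e \<noteq> e'" "u \<in> r e" "x \<in> r e'" for e e' u x
  proof -
    have "remote G y u" if "y \<in> e'" for y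
      using exchange[of e y u] M(2) that \<open>e \<in> M\<close> \<open>e' \<in> M\<close> \<open>e \<noteq> e'\<close> \<open>u \<in> r e\<close>
      unfolding mutually_remote_def by (simp add: remote_sym[of G y u])
    then show ?thesis
      using exchange[of e' u x] that by (simp add: remote_sym[of G u x])
  qed
  have "r e \<noteq> {}" if "e \<in> M" for e
    using r[OF that] G by (auto simp: finite_simple_graph_def)
  then have "inj_on r M"
    using far unfolding inj_on_def remote_def by (metis all_not_in_conv)
  then have "card (r ` M) = card M"
    by (rule card_image)
  moreover have "mutually_remote G (r ` M)"
    using far unfolding mutually_remote_def by blast
  ultimately show ?thesis
    using r by (intro exI[of _ "r ` M"]) auto
qed

section \<open>Comparing the two invariants\<close>

lemma Max_card_mono:
  assumes "finite E" "\<And>M. Q M \<Longrightarrow> M \<subseteq> E" "P {}"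
    and "\<And>M. P M \<Longrightarrow> \<exists>N. Q N \<and> card N = card M"
  shows "Max {card M | M. P M} \<le> Max {card M | M. Q M}"
proof (rule Max_mono)
  show "{card M | M. P M} \<subseteq> {card M | M. Q M}"
    using assms(4) by force
  show "{card M | M. P M} \<noteq> {}"
    using assms(3) by blast
  have "finite {M. Q M}"
    using assms(1,2) by (auto intro: finite_subset[of _ "Pow E"])
  then show "finite {card M | M. Q M}"
    by simp
qed

theorem proposition4p3:
  fixes G :: "'a graph"
  assumes "finite_simple_graph G" and "no_isolated_vertices G"
  shows "im (second_power G) \<ge> a3 G \<and> (claw_free G \<longrightarrow> im (second_power G) = a3 G)"
proof -
  note G = assms(1)
  note finite_E = finite_edges[OF G]
  note finite_H = finite_edges[OF finite_simple_graph_second_power[OF G]]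
  note iffs = induced_matching_second_power_iff_mutually_remote[OF G]
    distance_three_matching_iff_mutually_remote[OF G]
  have empty: "mutually_remote G {}"
    by (simp add: mutually_remote_def)
  have sub: "edges G \<subseteq> edges (second_power G)"
    by (auto simp: second_power_def)
  have "a3 G \<le> im (second_power G)"
    unfolding a3_def im_def iffs
    by (rule Max_card_mono[OF finite_H]) (use sub empty in auto)
  moreover have "im (second_power G) \<le> a3 G" if "claw_free G"
    unfolding a3_def im_def iffs
    by (rule Max_card_mono[OF finite_E])
      (use claw_free_exchange_matching[OF G that] empty in auto)
  ultimately show ?thesis
    by auto
qed

end
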